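(* Let $n\geq 2$ and let $f=1^{x_{1}}0^{y_{1}}1^{x_{2}}0^{y_{2}}\cdots 1^{x_{n}}0^{y_{n}}$ with integers $x_i\geq 1$, $y_i\geq 1$ for $i=1,\ldots,n$. If $f$ is good, then, up to replacing $f$ by the complement of its reverse, $1^{y_{n}}0^{x_{n}}1^{y_{n-1}}0^{x_{n-1}}\cdots 1^{y_{1}}0^{x_{1}}$ (i.e. replacing $(x_1,y_1,\ldots,x_n,y_n)$ by $(y_n,x_n,\ldots,y_1,x_1)$), at least one of the following holds: (a) $x_{1}=1$ and $y_{n}=y_{1}+1$; (b) $x_{1}=x_{n}=1$ and $y_{1}=y_{n}$; (c) $x_{1}=1$, $x_{n}\geq 2$ and $y_{1}=y_{n}+1$; (d) $x_{1}=1$, $x_{n}=2$ and $y_{1}\geq y_{n}+2$.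
   Context: All strings are binary; $1^a$ (resp. $0^a$) denotes the string of $a$ consecutive ones (resp. zeros), and juxtaposition is concatenation. $Q_d$ is the $d$-dimensional hypercube: its vertices are the binary strings of length $d$, two being adjacent iff they differ in exactly one bit. A string $f$ is a factor of $\mu$ if $f$ appears as $|f|$ consecutive bits of $\mu$. The generalized Fibonacci cube $Q_d(f)$ is the subgraph of $Q_d$ induced by all strings of length $d$ that do not contain $f$ as a factor. A subgraph $H$ of a connected graph $G$ is an isometric subgraph, written $H\hookrightarrow G$, if $d_H(\mu,\nu)=d_G(\mu,\nu)$ for all $\mu,\nu\in V(H)$ (with $d_H=\infty$ for vertices in different components of $H$). A string $f$ is good if $Q_d(f)\hookrightarrow Q_d$ for all $d\geq 1$, and bad otherwise. (The reverse of $a_1a_2\cdots a_m$ is $a_m\cdots a_2a_1$; the complement replaces each bit $a$ by $1-a$. Goodness is invariant under reversal and complementation.) *)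

theory Defs
  imports "Graph_Theory.Graph_Theory" "HOL-Library.Sublist"
begin

text \<open>
  Binary strings are of type \<^typ>\<open>bool list\<close>, with \<^term>\<open>True\<close> for the bit 1 and \<^term>\<open>False\<close> for
  the bit 0. Undirected graphs are symmetric digraphs whose arcs are pairs of vertices.
\<close>

definition hypercube :: "nat \<Rightarrow> bool list pair_pre_digraph" where
  "hypercube d =
    \<lparr> pverts = {u. length u = d},
      parcs = {(u, v). length u = d \<and> length v = d \<and> card {i. i < d \<and> u ! i \<noteq> v ! i} = 1} \<rparr>"

definition fib_cube :: "nat \<Rightarrow> bool list \<Rightarrow> (bool list, bool list \<times> bool list) pre_digraph" where
  "fib_cube d f = with_proj (hypercube d) \<restriction> {u. length u = d \<and> \<not> sublist f u}"

text \<open>The shortest path length; it is \<open>\<infinity>\<close> for vertices in different components.\<close>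

definition graph_dist :: "('a, 'b) pre_digraph \<Rightarrow> 'a \<Rightarrow> 'a \<Rightarrow> ereal" where
  "graph_dist G u v = wf_digraph.\<mu> G (\<lambda>_. 1) u v"

definition isometric_subgraph :: "('a, 'b) pre_digraph \<Rightarrow> ('a, 'b) pre_digraph \<Rightarrow> bool" where
  "isometric_subgraph H G \<longleftrightarrow>
    subgraph H G \<and> (\<forall>u \<in> verts H. \<forall>v \<in> verts H. graph_dist H u v = graph_dist G u v)"

definition good :: "bool list \<Rightarrow> bool" where
  "good f \<longleftrightarrow> (\<forall>d \<ge> 1. isometric_subgraph (fib_cube d f) (with_proj (hypercube d)))"

text \<open>\<open>blocks n x y\<close> is $1^{x_1} 0^{y_1} \cdots 1^{x_n} 0^{y_n}$; the indices run from 1 to \<open>n\<close>.\<close>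

definition blocks :: "nat \<Rightarrow> (nat \<Rightarrow> nat) \<Rightarrow> (nat \<Rightarrow> nat) \<Rightarrow> bool list" where
  "blocks n x y = concat (map (\<lambda>i. replicate (x i) True @ replicate (y i) False) [1..<Suc n])"

lemma blocks_rev_complement:
  "map Not (rev (blocks n x y)) = blocks n (\<lambda>i. y (n + 1 - i)) (\<lambda>i. x (n + 1 - i))"
proof -
  have rev_upt: "rev [1..<Suc n] = map (\<lambda>i. n + 1 - i) [1..<Suc n]"
    by (rule nth_equalityI) (auto simp: rev_nth simp del: upt_Suc)
  show ?thesis
    unfolding blocks_def map_concat rev_concat rev_map rev_upt map_map
    by (simp add: o_def del: upt_Suc)
qed

lemma pair_graph_hypercube: "pair_graph (hypercube d)"
proof
  show fin: "finite (pverts (hypercube d))"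
    using finite_lists_length_eq[of "UNIV :: bool set" d] by (simp add: hypercube_def)
  have "parcs (hypercube d) \<subseteq> pverts (hypercube d) \<times> pverts (hypercube d)"
    by (auto simp: hypercube_def)
  then show "finite (parcs (hypercube d))"
    using fin finite_subset by blast
  have "(v, u) \<in> parcs (hypercube d)" if uv: "(u, v) \<in> parcs (hypercube d)" for u v
  proof -
    have sets: "{i. i < d \<and> v ! i \<noteq> u ! i} = {i. i < d \<and> u ! i \<noteq> v ! i}"
      by blast
    have "length v = d \<and> length u = d \<and> card {i. i < d \<and> v ! i \<noteq> u ! i} = 1"
      unfolding sets using uv by (simp add: hypercube_def)
    then show ?thesis
      by (simp add: hypercube_def)
  qed
  then show "symmetric (with_proj (hypercube d))"
    by (simp add: symmetric_def sym_def)
  show "fst e \<noteq> snd e" if "e \<in> parcs (hypercube d)" for e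
    using that by (cases e) (clarsimp simp: hypercube_def)
qed (auto simp: hypercube_def)

lemma subgraph_fib_cube: "subgraph (fib_cube d f) (with_proj (hypercube d))"
proof -
  interpret pair_graph "hypercube d"
    by (rule pair_graph_hypercube)
  show ?thesis
    unfolding fib_cube_def
    by (rule induced_imp_subgraph, rule induced_induce) (auto simp: hypercube_def)
qed

end

theory Submission
  imports Defs
begin

text \<open>
  If both \<open>u\<close> and \<open>u + e\<^sub>i + e\<^sub>j\<close> contain \<open>f\<close> but \<open>u + e\<^sub>i\<close> and \<open>u + e\<^sub>j\<close> do not, then the latter two are
  at distance 2 in the cube but not in the Fibonacci cube. Such a square arises by letting two copies
  of \<open>f\<close> overlap whenever a prefix and the suffix of the same length differ in exactly two places \<open>i < j\<close>,
  unless a third copy of \<open>f\<close> appears; a third copy forces the shift to be \<open>2 (j - i)\<close> and \<open>f\<close> to have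
  period \<open>j - i\<close> up to one error. Every block pattern outside (a)--(d) has an overlap of this kind,
  read off its outer blocks, and the exceptional period is impossible except for
  \<open>f = 1 0^p 1 0^(2p+2)\<close>, where another overlap works.
\<close>

section \<open>Factors, cube edges and walk lengths\<close>

lemma sublist_iff_nth:
  "sublist f w \<longleftrightarrow> (\<exists>t. t + length f \<le> length w \<and> (\<forall>s < length f. w ! (t + s) = f ! s))"
proof
  assume "sublist f w"
  then obtain a b where "w = a @ f @ b"
    by (auto simp: sublist_def)
  then show "\<exists>t. t + length f \<le> length w \<and> (\<forall>s < length f. w ! (t + s) = f ! s)"
    by (intro exI[of _ "length a"]) (auto simp: nth_append)
next
  assume "\<exists>t. t + length f \<le> length w \<and> (\<forall>s < length f. w ! (t + s) = f ! s)"
  then obtain t where t: "t + length f \<le> length w" "\<forall>s < length f. w ! (t + s) = f ! s"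
    by blast
  have "f = take (length f) (drop t w)"
    using t by (intro nth_equalityI) auto
  then have "w = take t w @ f @ drop (length f) (drop t w)"
    by (metis append_take_drop_id)
  then show "sublist f w"
    by (metis sublist_appendI)
qed

lemma fib_cube_simps:
  "verts (fib_cube d f) = {u. length u = d \<and> \<not> sublist f u}"
  "arcs (fib_cube d f) = {(u, v). (u, v) \<in> parcs (hypercube d) \<and> \<not> sublist f u \<and> \<not> sublist f v}"
  "tail (fib_cube d f) = fst" "head (fib_cube d f) = snd"
  by (auto simp: fib_cube_def hypercube_def)

lemma hypercube_arc_iff:
  "(u, v) \<in> parcs (hypercube d) \<longleftrightarrow> length u = d \<and> (\<exists>a < d. v = u[a := \<not> u ! a])"
proof
  assume "(u, v) \<in> parcs (hypercube d)"
  then have len: "length u = d" "length v = d" and "card {i. i < d \<and> u ! i \<noteq> v ! i} = 1"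
    by (auto simp: hypercube_def)
  then obtain a where a: "{i. i < d \<and> u ! i \<noteq> v ! i} = {a}"
    by (auto simp: card_1_singleton_iff)
  then have "a < d" and "v ! a = (\<not> u ! a)" and "\<And>l. l < d \<Longrightarrow> l \<noteq> a \<Longrightarrow> v ! l = u ! l"
    by blast+
  then have "v = u[a := \<not> u ! a]"
    using len by (simp add: list_eq_iff_nth_eq nth_list_update)
  then show "length u = d \<and> (\<exists>a < d. v = u[a := \<not> u ! a])"
    using \<open>a < d\<close> len by blast
next
  assume "length u = d \<and> (\<exists>a < d. v = u[a := \<not> u ! a])"
  then obtain a where len: "length u = d" "a < d" and v: "v = u[a := \<not> u ! a]"
    by blast
  then have "u ! l \<noteq> v ! l \<longleftrightarrow> l = a" if "l < d" for l
    using that by (cases "l = a") simp_all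
  then have "{i. i < d \<and> u ! i \<noteq> v ! i} = {a}"
    using len(2) by blast
  with len v show "(u, v) \<in> parcs (hypercube d)"
    by (simp add: hypercube_def)
qed

text \<open>The distance is an infimum of walk costs in \<open>ereal\<close>. Unit costs are
  integral, so a value below \<open>n + 1\<close> is already witnessed by a walk of length at most
  \<open>n\<close>.\<close>

lemma (in wf_digraph) unit_distance_le_iff:
  "\<mu> (\<lambda>_. 1) u v \<le> ereal (real n) \<longleftrightarrow> (\<exists>p. awalk u p v \<and> length p \<le> n)"
proof -
  have cost: "awalk_cost (\<lambda>_. 1) p = real (length p)" for p :: "'b list"
    by (simp add: awalk_cost_def sum_list_triv)
  show ?thesis
  proof
    assume "\<mu> (\<lambda>_. 1) u v \<le> ereal (real n)"
    also have "\<dots> < ereal (real n + 1)"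
      by simp
    finally have "\<mu> (\<lambda>_. 1) u v < ereal (real n + 1)" .
    then obtain p where "awalk u p v" "real (length p) < real n + 1"
      by (auto simp: \<mu>_def INF_less_iff cost)
    then show "\<exists>p. awalk u p v \<and> length p \<le> n"
      by (intro exI[of _ p]) linarith
  next
    assume "\<exists>p. awalk u p v \<and> length p \<le> n"
    then obtain p where "awalk u p v" "length p \<le> n"
      by blast
    then have "\<mu> (\<lambda>_. 1) u v \<le> ereal (real (length p))"
      using min_cost_le_walk_cost[of u p v "\<lambda>_. 1"] by (simp only: cost)
    also have "\<dots> \<le> ereal (real n)"
      using \<open>length p \<le> n\<close> by simp
    finally show "\<mu> (\<lambda>_. 1) u v \<le> ereal (real n)" .
  qed
qed

section \<open>Squares of the cube and goodness\<close>

text \<open>Flipping \<open>i\<close> or \<open>j\<close> alone gives two words at distance 2. Their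
  only common neighbours are \<open>u\<close> and the word with both bits flipped. Both of these
  contain \<open>f\<close>, so no walk of length at most 2 survives in the Fibonacci cube.\<close>

lemma good_square:
  assumes "good f" and ij: "i < length u" "j < length u" "i \<noteq> j"
    and u: "sublist f u" and uij: "sublist f (u[i := \<not> u ! i, j := \<not> u ! j])"
  shows "sublist f (u[i := \<not> u ! i]) \<or> sublist f (u[j := \<not> u ! j])"
proof (rule ccontr)
  define d where "d = length u"
  define b where "b = u[i := \<not> u ! i]"
  define c where "c = u[j := \<not> u ! j]"
  let ?Q = "with_proj (hypercube d)" and ?H = "fib_cube d f"
  assume "\<not> (sublist f (u[i := \<not> u ! i]) \<or> sublist f (u[j := \<not> u ! j]))"
  then have "\<not> sublist f b" "\<not> sublist f c"
    by (auto simp: b_def c_def)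
  have nbc: "b ! i \<noteq> c ! i" "b ! j \<noteq> c ! j" and "length b = d" "length c = d"
    using ij by (auto simp: b_def c_def d_def)
  then have bc: "b \<in> verts ?H" "c \<in> verts ?H" "b \<noteq> c"
    using \<open>\<not> sublist f b\<close> \<open>\<not> sublist f c\<close> by (auto simp: fib_cube_simps)
  have wf: "wf_digraph ?Q" "wf_digraph ?H"
    using subgraph_fib_cube by (auto simp: subgraph_def)
  have "(b, u) \<in> parcs (hypercube d)" "(u, c) \<in> parcs (hypercube d)" "c \<in> pverts (hypercube d)"
    using ij unfolding hypercube_arc_iff
    by (auto simp: b_def c_def d_def hypercube_def intro: exI[of _ i])
  then have "pre_digraph.awalk ?Q b [(b, u), (u, c)] c"
    by (simp add: wf_digraph.awalk_simps[OF wf(1)])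
  then have "graph_dist ?Q b c \<le> ereal (real 2)"
    unfolding graph_dist_def wf_digraph.unit_distance_le_iff[OF wf(1)]
    by (intro exI[of _ "[(b, u), (u, c)]"]) simp
  moreover have "graph_dist ?H b c = graph_dist ?Q b c"
    using \<open>good f\<close> bc ij by (auto simp: good_def isometric_subgraph_def d_def)
  ultimately obtain p where p: "pre_digraph.awalk ?H b p c" "length p \<le> 2"
    unfolding graph_dist_def by (metis wf_digraph.unit_distance_le_iff[OF wf(2)])
  consider e where "p = [e]" | e e' where "p = [e, e']"
  proof (cases p)
    case Nil
    then show thesis
      using p(1) bc(3) by (simp add: wf_digraph.awalk_simps[OF wf(2)])
  next
    case (Cons e es)
    then show thesis
      using p(2) that by (cases es) auto
  qed
  then show False
  proof cases
    case 1
    then have "(b, c) \<in> parcs (hypercube d)"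
      using p by (auto simp: wf_digraph.awalk_simps[OF wf(2)] fib_cube_simps)
    then obtain a where "c = b[a := \<not> b ! a]"
      by (auto simp: hypercube_arc_iff)
    then have "c ! l = b ! l" if "l \<noteq> a" for l
      using that by simp
    then show False
      using nbc \<open>i \<noteq> j\<close> by metis
  next
    case 2
    then obtain w where w: "(b, w) \<in> parcs (hypercube d)" "(w, c) \<in> parcs (hypercube d)"
        "\<not> sublist f w"
      using p by (cases e, cases e') (auto simp: wf_digraph.awalk_simps[OF wf(2)] fib_cube_simps)
    then obtain a a' where a: "w = b[a := \<not> b ! a]" "c = w[a' := \<not> w ! a']"
      by (auto simp: hypercube_arc_iff)
    then have "c ! l = b ! l" if "l \<noteq> a" "l \<noteq> a'" for l
      using that by simp
    then have "a = i \<or> a = j"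
      using nbc \<open>i \<noteq> j\<close> by metis
    then have "w = u \<or> w = u[i := \<not> u ! i, j := \<not> u ! j]"
      using ij a(1) by (auto simp: b_def)
    then show False
      using w(3) u uij by blast
  qed
qed

text \<open>This is all that the proof uses of goodness. It mentions words only, so its invariance
  under reverse complement needs no graph isomorphism.\<close>

definition square_closed :: "bool list \<Rightarrow> bool" where
  "square_closed f \<longleftrightarrow> (\<forall>u i j. i < length u \<longrightarrow> j < length u \<longrightarrow> i \<noteq> j \<longrightarrow>
    sublist f u \<longrightarrow> sublist f (u[i := \<not> u ! i, j := \<not> u ! j]) \<longrightarrow>
    sublist f (u[i := \<not> u ! i]) \<or> sublist f (u[j := \<not> u ! j]))"

lemma sublist_rev_complement:
  "sublist (map Not (rev f)) (map Not (rev u)) \<longleftrightarrow> sublist f u"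
proof -
  have "sublist (map Not g) (map Not v)" if "sublist g v" for g v
    using that by (metis map_append sublist_def)
  from this[of f u] this[of "map Not f" "map Not u"]
  have "sublist (map Not f) (map Not u) \<longleftrightarrow> sublist f u"
    by (auto simp: o_def)
  then show ?thesis
    by (simp add: rev_map[symmetric] sublist_rev)
qed

text \<open>Reverse complement is an involution that preserves factors and turns a flip at position
  \<open>l\<close> of \<open>v\<close> into a flip at \<open>length v - Suc l\<close>. Squares
  therefore go to squares.\<close>

lemma square_closed_rev_complement:
  assumes "square_closed f"
  shows "square_closed (map Not (rev f))"
  unfolding square_closed_def
proof (intro allI impI)
  fix u :: "bool list" and i j
  define R where "R = (\<lambda>v :: bool list. map Not (rev v))"
  define i' j' where "i' = length u - Suc i" and "j' = length u - Suc j"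
  have RR: "R (R v) = v" for v
    by (simp add: R_def rev_map o_def)
  have sub: "sublist (R f) v \<longleftrightarrow> sublist f (R v)" for v
    using sublist_rev_complement[of f "R v"] RR[of v] by (simp add: R_def)
  assume ij: "i < length u" "j < length u" "i \<noteq> j"
  then have ij': "i' < length (R u)" "j' < length (R u)" "i' \<noteq> j'"
    by (auto simp: R_def i'_def j'_def)
  have upd: "R (v[l := b]) = (R v)[length v - Suc l := \<not> b]" if "l < length v" for v l b
    using that by (simp add: R_def rev_update map_update)
  have nth: "R u ! i' = (\<not> u ! i)" "R u ! j' = (\<not> u ! j)"
    using ij by (simp_all add: R_def i'_def j'_def rev_nth)
  have R_f: "map Not (rev f) = R f"
    by (simp add: R_def)
  assume "sublist (map Not (rev f)) u" "sublist (map Not (rev f)) (u[i := \<not> u ! i, j := \<not> u ! j])"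
  then have "sublist f (R u)" "sublist f ((R u)[i' := \<not> R u ! i', j' := \<not> R u ! j'])"
    using ij by (simp_all add: R_f sub upd nth flip: i'_def j'_def)
  then have "sublist f ((R u)[i' := \<not> R u ! i']) \<or> sublist f ((R u)[j' := \<not> R u ! j'])"
    using assms ij' by (auto simp: square_closed_def)
  then show "sublist (map Not (rev f)) (u[i := \<not> u ! i]) \<or> sublist (map Not (rev f)) (u[j := \<not> u ! j])"
    using ij by (simp add: R_f sub upd nth flip: i'_def j'_def)
qed

section \<open>Overlaps of two copies with two errors\<close>

text \<open>
  In the overlap \<open>u\<close> of two copies of \<open>f\<close> at distance \<open>k\<close> that disagree at \<open>e\<close> and \<open>e'\<close> only, with
  the conflict at \<open>e'\<close> resolved in favour of the first copy and the one at \<open>e\<close> in favour of the second,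
  a third copy of \<open>f\<close> has to start halfway between the two.
\<close>

lemma third_copy:
  fixes f :: "bool list" and e e' k :: nat
  defines "m \<equiv> length f" and "u \<equiv> f @ drop (length f - k) f"
  assumes e: "e \<noteq> e'" "k \<le> e" "k \<le> e'" "e < m" "e' < m"
    and overlap: "\<forall>s \<in> {k..<m}. f ! s \<noteq> f ! (s - k) \<longleftrightarrow> s = e \<or> s = e'"
    and t: "t \<le> k" "\<forall>s < m. u[e := \<not> u ! e] ! (t + s) = f ! s"
  shows "e' = e + t \<and> k = 2 * t \<and> (\<forall>s \<in> {t..<m}. f ! s \<noteq> f ! (s - t) \<longleftrightarrow> s = e)"
proof -
  have u_fst: "u ! s = f ! s" if "s < m" for s
    using that by (simp add: u_def m_def nth_append)
  \<comment> \<open>On Booleans \<open>\<noteq>\<close> is exclusive or: \<open>u\<close> reads the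
    second copy with the bits at \<open>e\<close> and \<open>e'\<close> flipped.\<close>
  have u_snd: "u ! s = (f ! (s - k) \<noteq> (s = e \<or> s = e'))" if "s \<in> {k..<m + k}" for s
  proof (cases "s < m")
    case True
    then show ?thesis
      using that overlap u_fst[of s] by auto
  next
    case False
    then show ?thesis
      using that e by (auto simp: u_def m_def nth_append)
  qed
  have len: "length u = m + k"
    using e by (simp add: u_def m_def)
  \<comment> \<open>Third copy against the first: the flip at \<open>e\<close> is the only
    error.\<close>
  have first: "f ! (s - t) = (f ! s \<noteq> (s = e))" if "s \<in> {t..<m}" for s
  proof -
    have "u[e := \<not> u ! e] ! s = f ! (s - t)"
      using t(2)[rule_format, of "s - t"] that by auto
    then show ?thesis
      using that e(4) len u_fst[of s] by (cases "s = e") auto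
  qed
  \<comment> \<open>Third copy against the second: the flip repaired \<open>e\<close>, so only
    \<open>e'\<close> remains.\<close>
  have second: "f ! s = (f ! (s + t - k) \<noteq> (s + t = e'))" if "s \<in> {k - t..<m}" for s
  proof -
    have "u[e := \<not> u ! e] ! (s + t) = f ! s"
      using t(2)[rule_format, of s] that by (simp add: add.commute)
    moreover have "s + t \<in> {k..<m + k}"
      using that t(1) by auto
    ultimately show ?thesis
      using that e len u_snd[of "s + t"] by (cases "s + t = e") auto
  qed
  have "t > 0"
    using first[of e] e by (cases "t = 0") auto
  have "t < k"
  proof (rule ccontr)
    assume "\<not> t < k"
    then have "t = k" "e' - k \<in> {k - t..<m}"
      using e t(1) by auto
    then show False
      using second[of "e' - k"] e by simp
  qed
  \<comment> \<open>Composing the shifts \<open>k - t\<close> and \<open>t\<close> gives the shift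
    \<open>k\<close>, whose errors are known from \<open>overlap\<close>. Matching them at
    \<open>e\<close> and at \<open>e'\<close> determines \<open>t\<close>.\<close>
  have both: "f ! s \<noteq> f ! (s - k) \<longleftrightarrow> (s + t = e') \<noteq> (s + t = e + k)" if "s \<in> {k..<m}" for s
  proof -
    have "s \<in> {k - t..<m}" "s + t - k \<in> {t..<m}" "s + t - k - t = s - k"
        "s + t - k = e \<longleftrightarrow> s + t = e + k"
      using that \<open>t < k\<close> by auto
    then show ?thesis
      using second[of s] first[of "s + t - k"] by auto
  qed
  have "e + t = e'"
    using both[of e] overlap e \<open>t < k\<close> by auto
  moreover have "e' + t = e + k"
    using both[of e'] overlap e \<open>t > 0\<close> by auto
  ultimately show ?thesis
    using first by auto
qed

text \<open>The overlay \<open>u\<close> contains the first copy, and flipping \<open>i\<close> and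
  \<open>j\<close> produces the second. Square-closedness then puts a copy of \<open>f\<close> into
  one of the two words with a single flip, where \<open>third_copy\<close> applies.\<close>

lemma two_error_overlap:
  assumes "square_closed f" "i < j" "k \<le> i" "j < length f"
    and overlap: "\<forall>s \<in> {k..<length f}. f ! s \<noteq> f ! (s - k) \<longleftrightarrow> s = i \<or> s = j"
  shows "k = 2 * (j - i)" "\<forall>s \<in> {j - i..<length f}. f ! s \<noteq> f ! (s - (j - i)) \<longleftrightarrow> s = i"
proof -
  define u where "u = f @ drop (length f - k) f"
  have len: "length u = length f + k"
    using assms by (simp add: u_def)
  have "u[i := \<not> u ! i, j := \<not> u ! j] ! (k + s) = f ! s" if "s < length f" for s
  proof (cases "k + s < length f")
    case True
    then have "u ! (k + s) = f ! (k + s)"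
      by (simp add: u_def nth_append)
    then show ?thesis
      using overlap[rule_format, of "k + s"] True that assms(2-4) len
      by (auto simp: nth_list_update)
  next
    case False
    then show ?thesis
      using that assms(2-4) by (auto simp: u_def nth_append)
  qed
  then have "sublist f (u[i := \<not> u ! i, j := \<not> u ! j])"
    using len by (auto simp: sublist_iff_nth)
  moreover have "sublist f u"
    by (simp add: u_def)
  ultimately have "sublist f (u[i := \<not> u ! i]) \<or> sublist f (u[j := \<not> u ! j])"
    using assms(1-4) len unfolding square_closed_def by simp
  \<comment> \<open>Which of \<open>i\<close>, \<open>j\<close> was flipped is left open here;
    \<open>e' = e + t\<close> later forces \<open>e\<close> to be the smaller one.\<close>
  then obtain e e' t where "{e, e'} = {i, j}"
      and t: "t \<le> k" "\<forall>s < length f. u[e := \<not> u ! e] ! (t + s) = f ! s"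
    unfolding sublist_iff_nth using len by (auto simp: doubleton_eq_iff)
  then have e: "e \<noteq> e'" "k \<le> e" "k \<le> e'" "e < length f" "e' < length f"
    using assms(2-4) by (auto simp: doubleton_eq_iff)
  have "\<forall>s \<in> {k..<length f}. f ! s \<noteq> f ! (s - k) \<longleftrightarrow> s = e \<or> s = e'"
    using overlap \<open>{e, e'} = {i, j}\<close> by (auto simp: doubleton_eq_iff)
  from third_copy[OF e this t[unfolded u_def]]
  have *: "e' = e + t" "k = 2 * t" "\<forall>s \<in> {t..<length f}. f ! s \<noteq> f ! (s - t) \<longleftrightarrow> s = e"
    by blast+
  then have "e = i" "t = j - i"
    using \<open>{e, e'} = {i, j}\<close> \<open>i < j\<close> by (auto simp: doubleton_eq_iff)
  with * show "k = 2 * (j - i)"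
    "\<forall>s \<in> {j - i..<length f}. f ! s \<noteq> f ! (s - (j - i)) \<longleftrightarrow> s = i"
    by auto
qed

text \<open>The same with errors counted from the start of a prefix of length \<open>l\<close> that
  is compared with the suffix of that length.\<close>

corollary two_error_border:
  assumes "square_closed f" "length f = k + l" "a < b" "b < l"
    and errors: "\<And>s. s < l \<Longrightarrow> f ! (k + s) \<noteq> f ! s \<longleftrightarrow> s = a \<or> s = b"
  shows "k = 2 * (b - a)" "\<forall>s \<in> {b - a..<length f}. f ! s \<noteq> f ! (s - (b - a)) \<longleftrightarrow> s = k + a"
proof -
  have overlap: "\<forall>s \<in> {k..<length f}. f ! s \<noteq> f ! (s - k) \<longleftrightarrow> s = k + a \<or> s = k + b"
  proof
    fix s assume "s \<in> {k..<length f}"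
    then obtain c where "s = k + c" "c < l"
      using assms(2) by (metis atLeastLessThan_iff le_iff_add nat_add_left_cancel_less)
    then show "f ! s \<noteq> f ! (s - k) \<longleftrightarrow> s = k + a \<or> s = k + b"
      using errors[of c] by simp
  qed
  have "k + a < k + b" "k \<le> k + a" "k + b < length f"
    using assms(2-4) by simp_all
  from two_error_overlap[OF assms(1) this overlap]
  show "k = 2 * (b - a)"
    "\<forall>s \<in> {b - a..<length f}. f ! s \<noteq> f ! (s - (b - a)) \<longleftrightarrow> s = k + a"
    by (simp_all only: diff_add_inverse add_diff_cancel_left)
qed

section \<open>Restrictions on the outer blocks\<close>

lemma nth_prefix_block:
  assumes "f = True # replicate p False @ True # g" "s \<le> p + 1"
  shows "f ! s \<longleftrightarrow> s = 0 \<or> s = p + 1"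
  using assms by (cases s) (auto simp: nth_append)

lemma nth_suffix_block:
  assumes "f = h @ False # replicate r True @ replicate q False" "length h \<le> s" "s < length f"
  shows "f ! s \<longleftrightarrow> length h < s \<and> s \<le> length h + r"
proof -
  obtain l where "s = length h + l"
    using assms(2) le_Suc_ex by blast
  then show ?thesis
    using assms by (cases l) (auto simp: nth_append)
qed

text \<open>Otherwise the prefix \<open>11\<close> and the suffix \<open>00\<close> differ in two
  adjacent places. This forces shift 2, but \<open>f\<close> is too long for that.\<close>

lemma square_closed_outer_blocks:
  assumes "square_closed f"
    and pre: "f = replicate a True @ replicate p False @ True # g"
    and suf: "f = h @ False # replicate r True @ replicate q False"
    and h: "a + p \<le> length h + 1" and pos: "a \<ge> 1" "p \<ge> 1" "r \<ge> 1" "q \<ge> 1"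
  shows "a = 1 \<or> q = 1"
proof (rule ccontr)
  assume "\<not> (a = 1 \<or> q = 1)"
  then have "a \<ge> 2" "q \<ge> 2"
    using pos by auto
  define k where "k = length h + r + q - 1"
  have k: "length f = k + 2"
    using \<open>q \<ge> 2\<close> by (simp add: suf k_def)
  have "f ! s" "\<not> f ! (k + s)" if "s < 2" for s
    using that nth_suffix_block[OF suf, of "k + s"] \<open>a \<ge> 2\<close> \<open>q \<ge> 2\<close> k
    by (auto simp: pre nth_append k_def)
  then have "f ! (k + s) \<noteq> f ! s \<longleftrightarrow> s = 0 \<or> s = 1" if "s < 2" for s
    using that by auto
  from two_error_border(1)[OF \<open>square_closed f\<close> k _ _ this] have "k = 2"
    by simp
  then show False
    using h \<open>a \<ge> 2\<close> \<open>q \<ge> 2\<close> pos by (auto simp: k_def)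
qed

lemma square_closed_last_blocks:
  assumes "square_closed f"
    and pre: "f = True # replicate p False @ True # g"
    and suf: "f = h @ False # replicate r True @ replicate q False"
    and h: "p \<le> length h" and pos: "p \<ge> 1" "r \<ge> 1" "q \<ge> 1"
  shows "q = p + 1 \<or> (r = 1 \<and> p = q) \<or> (r \<ge> 2 \<and> p = q + 1) \<or> (r = 2 \<and> p \<ge> q + 2)"
proof (rule ccontr)
  assume neg: "\<not> ?thesis"
  let ?m = "length f"
  have m: "?m = length h + 1 + r + q"
    by (simp add: suf)
  note first = nth_prefix_block[OF pre] and last = nth_suffix_block[OF suf]
  note border = two_error_border[OF \<open>square_closed f\<close>]
  consider "q \<ge> p + 2" | "q = p" "r \<ge> 2" | "q < p" "r = 1" | "q + 2 \<le> p" "r \<ge> 3"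
    using neg pos by linarith
  then show False
  proof cases
    \<comment> \<open>Prefix \<open>1 0^p 1\<close> against suffix \<open>0^(p+2)\<close>: errors at
      \<open>0\<close> and \<open>p + 1\<close>.\<close>
    case 1
    define k where "k = length h + r + q - (p + 1)"
    have k: "?m = k + (p + 2)" "length h + r < k"
      using 1 m by (simp_all add: k_def)
    have zeros: "\<not> f ! (k + s)" if "s < p + 2" for s
      using that last[of "k + s"] k by simp
    have "f ! (k + s) \<noteq> f ! s \<longleftrightarrow> s = 0 \<or> s = p + 1" if "s < p + 2" for s
      using zeros[OF that] first[of s] that by simp
    note this_border = border[OF k(1) _ _ this]
    have k2: "k = 2 * (p + 1)"
      using this_border(1) by simp
    have period: "f ! s \<noteq> f ! (s - (p + 1)) \<longleftrightarrow> s = k" if "s \<in> {p + 1..<?m}" for s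
      using this_border(2)[rule_format, of s] that by simp
    \<comment> \<open>Here \<open>f\<close> is \<open>1 0^p 1 0^(2p+2)\<close>, so the overlap that is longer by one has two errors as well.\<close>
    have next_zero: "\<not> f ! (p + 2)"
      using period[of "p + 2"] first[of 1] k(1) k2 pos by simp
    define k' where "k' = 2 * p + 1"
    have k': "k = k' + 1" "?m = k' + (p + 3)"
      using k(1) k2 by (simp_all add: k'_def)
    have "\<not> f ! k'"
      using period[of k'] first[of p] k' pos by (simp add: k'_def)
    then have zeros': "\<not> f ! (k' + s)" if "s < p + 3" for s
      using zeros[of "s - 1"] k'(1) that by (cases s) auto
    have "f ! (k' + s) \<noteq> f ! s \<longleftrightarrow> s = 0 \<or> s = p + 1" if "s < p + 3" for s
      using zeros'[OF that] first[of s] next_zero that by (cases "s = p + 2") auto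
    \<comment> \<open>The errors are again \<open>p + 1\<close> apart, so the shift would be
      \<open>2 * (p + 1)\<close>, but \<open>k'\<close> is one less.\<close>
    from border(1)[OF k'(2) _ _ this] show False
      by (simp add: k'_def)
  next
    \<comment> \<open>Prefix \<open>1 0^p 1\<close> against suffix \<open>1 1 0^p\<close>: errors at
      \<open>1\<close> and \<open>p + 1\<close>. The shift is \<open>2 * p\<close>, and the period
      \<open>p\<close> has its only error at \<open>k + 1\<close>, so it would equate bits
      \<open>p\<close> and \<open>0\<close>.\<close>
    case 2
    define k where "k = length h + r - 1"
    have k: "?m = k + (p + 2)" "length h < k" "k + 1 = length h + r"
      using 2 m by (simp_all add: k_def)
    have "f ! (k + s) \<noteq> f ! s \<longleftrightarrow> s = 1 \<or> s = p + 1" if "s < p + 2" for s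
    proof -
      have "f ! (k + s) \<longleftrightarrow> s \<le> 1"
        using last[of "k + s"] that k by auto
      then show ?thesis
        using first[of s] that pos by auto
    qed
    note this_border = border[OF k(1) _ _ this]
    have "f ! p \<longleftrightarrow> f ! 0"
      using this_border(1) this_border(2)[rule_format, of p] k(1) pos by simp
    then show False
      using first[of p] first[of 0] pos by simp
  next
    \<comment> \<open>Prefix \<open>1 0^(q+1)\<close> against suffix \<open>0 1 0^q\<close>: errors
      at \<open>0\<close> and \<open>1\<close>. The shift is 2, and the period 1 has its only error
      at \<open>k\<close>, so it would equate bits \<open>1\<close> and \<open>0\<close>.\<close>
    case 3
    define k where "k = length h"
    have k: "?m = k + (q + 2)"
      using 3 m by (simp add: k_def)
    have "f ! (k + s) \<noteq> f ! s \<longleftrightarrow> s = 0 \<or> s = 1" if "s < q + 2" for s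
    proof -
      have "f ! (k + s) \<longleftrightarrow> s = 1"
        using last[of "k + s"] that k 3 by (auto simp: k_def)
      then show ?thesis
        using first[of s] that 3 by auto
    qed
    note this_border = border[OF k _ _ this]
    have "f ! 1 \<longleftrightarrow> f ! 0"
      using this_border(1) this_border(2)[rule_format, of 1] k by simp
    then show False
      using first[of 1] first[of 0] pos by simp
  next
    \<comment> \<open>Prefix \<open>1 0^(q+2)\<close> against suffix \<open>1 1 1 0^q\<close>:
      errors at \<open>1\<close> and \<open>2\<close>. Again period 1 would equate bits
      \<open>1\<close> and \<open>0\<close>.\<close>
    case 4
    define k where "k = length h + r - 2"
    have k: "?m = k + (q + 3)" "length h < k" "k + 2 = length h + r"
      using 4 m by (simp_all add: k_def)
    have "f ! (k + s) \<noteq> f ! s \<longleftrightarrow> s = 1 \<or> s = 2" if "s < q + 3" for s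
    proof -
      have "f ! (k + s) \<longleftrightarrow> s \<le> 2"
        using last[of "k + s"] that k by auto
      then show ?thesis
        using first[of s] that 4 by auto
    qed
    note this_border = border[OF k(1) _ _ this]
    have "f ! 1 \<longleftrightarrow> f ! 0"
      using this_border(1) this_border(2)[rule_format, of 1] k(1) by simp
    then show False
      using first[of 1] first[of 0] pos by simp
  qed
qed

section \<open>Block words and the final case split\<close>

text \<open>The word \<open>h\<close> is everything before the last block, less its final zero. It
  comes from at least one whole block because \<open>n \<ge> 2\<close>, which gives the length
  bound.\<close>

lemma blocks_outer:
  assumes "n \<ge> 2" and pos: "\<forall>i \<in> {1..n}. x i \<ge> 1 \<and> y i \<ge> 1"
  obtains g h where
    "blocks n x y = replicate (x 1) True @ replicate (y 1) False @ True # g"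
    "blocks n x y = h @ False # replicate (x n) True @ replicate (y n) False"
    "x 1 + y 1 \<le> length h + 1"
proof -
  define B where "B = (\<lambda>i. replicate (x i) True @ replicate (y i) False)"
  have blocks: "blocks n x y = concat (map B [1..<Suc n])"
    by (simp add: blocks_def B_def)
  have B_hd: "B i = True # replicate (x i - 1) True @ replicate (y i) False" if "i \<in> {1..n}" for i
  proof -
    have "x i \<ge> 1"
      using pos that by blast
    then show ?thesis
      unfolding B_def by (cases "x i") auto
  qed
  have B_last: "B i = (replicate (x i) True @ replicate (y i - 1) False) @ [False]" if "i \<in> {1..n}" for i
  proof -
    have "y i \<ge> 1"
      using pos that by blast
    then show ?thesis
      unfolding B_def by (cases "y i") (auto simp flip: replicate_append_same)
  qed
  have "[1..<Suc n] = 1 # 2 # [3..<Suc n]"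
    using \<open>n \<ge> 2\<close> by (simp add: upt_conv_Cons numeral_2_eq_2 numeral_3_eq_3 del: upt_Suc)
  then have "blocks n x y = B 1 @ B 2 @ concat (map B [3..<Suc n])"
    by (simp add: blocks del: upt_Suc)
  then have pre: "blocks n x y = replicate (x 1) True @ replicate (y 1) False @ True #
      (replicate (x 2 - 1) True @ replicate (y 2) False @ concat (map B [3..<Suc n]))"
    using \<open>n \<ge> 2\<close> by (simp add: B_hd[of 2]) (simp add: B_def)
  define h where "h = concat (map B [1..<n - 1]) @ replicate (x (n - 1)) True @ replicate (y (n - 1) - 1) False"
  have h: "concat (map B [1..<n]) = h @ [False]"
    using \<open>n \<ge> 2\<close> upt_Suc_append[of 1 "n - 1"] by (simp add: h_def B_last[of "n - Suc 0"])
  then have suf: "blocks n x y = h @ False # replicate (x n) True @ replicate (y n) False"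
    using \<open>n \<ge> 2\<close> by (simp add: blocks B_def)
  have "concat (map B [1..<n]) = B 1 @ concat (map B [2..<n])"
    using \<open>n \<ge> 2\<close> by (simp add: upt_conv_Cons numeral_2_eq_2)
  from arg_cong[OF this, of length] have "x 1 + y 1 \<le> length h + 1"
    unfolding h by (simp add: B_def)
  with pre suf show thesis
    by (rule that)
qed

lemma square_closed_blocks_cases:
  assumes "n \<ge> 2" "\<forall>i \<in> {1..n}. x i \<ge> 1 \<and> y i \<ge> 1" "square_closed (blocks n x y)"
  shows "x 1 = 1 \<or> y n = 1"
    and "x 1 = 1 \<Longrightarrow> y n = y 1 + 1 \<or> (x n = 1 \<and> y 1 = y n) \<or>
      (x n \<ge> 2 \<and> y 1 = y n + 1) \<or> (x n = 2 \<and> y 1 \<ge> y n + 2)"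
proof -
  obtain g h where gh:
    "blocks n x y = replicate (x 1) True @ replicate (y 1) False @ True # g"
    "blocks n x y = h @ False # replicate (x n) True @ replicate (y n) False"
    "x 1 + y 1 \<le> length h + 1"
    using blocks_outer[OF assms(1,2)] by blast
  have pos: "x 1 \<ge> 1" "y 1 \<ge> 1" "x n \<ge> 1" "y n \<ge> 1"
    using assms(1,2) by auto
  show "x 1 = 1 \<or> y n = 1"
    using square_closed_outer_blocks[OF assms(3) gh pos] .
  show "y n = y 1 + 1 \<or> (x n = 1 \<and> y 1 = y n) \<or>
      (x n \<ge> 2 \<and> y 1 = y n + 1) \<or> (x n = 2 \<and> y 1 \<ge> y n + 2)" if "x 1 = 1"
    using square_closed_last_blocks[OF assms(3) _ gh(2) _ pos(2-4), of g] gh(1,3) that by simp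
qed

theorem theorem1p1:
  fixes n :: nat and x y :: "nat \<Rightarrow> nat"
  assumes "n \<ge> 2"
    and "\<forall>i \<in> {1..n}. x i \<ge> 1 \<and> y i \<ge> 1"
    and "good (blocks n x y)"
  shows "\<exists>(a, b) \<in> {(x, y), (\<lambda>i. y (n + 1 - i), \<lambda>i. x (n + 1 - i))}.
      (a 1 = 1 \<and> b n = b 1 + 1) \<or>
      (a 1 = 1 \<and> a n = 1 \<and> b 1 = b n) \<or>
      (a 1 = 1 \<and> a n \<ge> 2 \<and> b 1 = b n + 1) \<or>
      (a 1 = 1 \<and> a n = 2 \<and> b 1 \<ge> b n + 2)"
proof -
  let ?x = "\<lambda>i. y (n + 1 - i)" and ?y = "\<lambda>i. x (n + 1 - i)"
  have closed: "square_closed (blocks n x y)"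
    using good_square[OF assms(3)] by (simp add: square_closed_def)
  then have closed': "square_closed (blocks n ?x ?y)"
    using square_closed_rev_complement by (simp only: flip: blocks_rev_complement)
  have "n + 1 - i \<in> {1..n}" if "i \<in> {1..n}" for i
    using that by auto
  then have pos': "\<forall>i \<in> {1..n}. ?x i \<ge> 1 \<and> ?y i \<ge> 1"
    using assms(2) by blast
  show ?thesis
  \<comment> \<open>If \<open>x 1\<close> is not 1 then \<open>y n = 1\<close>, and
    \<open>y n\<close> is the first exponent of the reverse complement.\<close>
  proof (cases "x 1 = 1")
    case True
    then show ?thesis
      using square_closed_blocks_cases(2)[OF assms(1,2) closed True] by auto
  next
    case False
    then have "?x 1 = 1"
      using square_closed_blocks_cases(1)[OF assms(1,2) closed] by simp
    then show ?thesis
      using square_closed_blocks_cases(2)[OF assms(1) pos' closed' \<open>?x 1 = 1\<close>] by auto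
  qed
qed

end
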